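(* Let $n,\sigma,M$ be positive integers, $\tau\in\mathbb{Z}$, let $0<m_1<\dots<m_n<M$ be integers, let $0<\Delta\le \pi/(2M)$, and let $\alpha_1,\dots,\alpha_n\in\mathbb{C}$. For $s\in\mathbb{Z}$ put $f_s=\sum_{i=1}^n\alpha_i S_{m_i}(\sin^2(s\Delta))$, where $S_m$ denotes the degree $m$ spread polynomial. Then the $n\times n$ matrices ${}^{\tau}_{\sigma}K_n$ and ${}_{\sigma}J_n$ built from these samples (defined in the context) factorize as $${}^{\tau}_{\sigma}K_n=R_nL_nA_nR_n^T,\qquad {}_{\sigma}J_n=R_nA_nR_n^T,$$ where $R_n=\big(S_{m_i}(\sin^2(k\sigma\Delta))\big)_{k=1,\dots,n;\ i=1,\dots,n}$ (row index $k$, column index $i$), $A_n=\mathrm{diag}(\alpha_1,\dots,\alpha_n)$ and $$L_n=\mathrm{diag}\big(S_{m_1}(\sin^2(\tau\Delta)),\dots,S_{m_n}(\sin^2(\tau\Delta))\big)=\mathrm{diag}\big(\sin^2(m_1\tau\Delta),\dots,\sin^2(m_n\tau\Delta)\big).$$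
   Context: The spread polynomial $S_m$ is defined on $[0,1]$ by $S_m(t)=\sin^2(m\theta)$ where $t=\sin^2\theta$. For fixed $\sigma,\tau$ and $j\in\mathbb{Z}$, define $$F_{\tau+j\sigma}:=F(\sigma,\tau;j):=\tfrac12\,(f_\tau+f_{j\sigma})-\tfrac14\,(f_{\tau+j\sigma}+f_{\tau-j\sigma})$$ (the notation $F_{\tau+j\sigma}$ refers to the fixed triple $\sigma,\tau,j$, not to the value of the integer $\tau+j\sigma$). The matrices are $${}_{\sigma}J_n:=\Big(\tfrac12 f_{k\sigma}+\tfrac12 f_{\ell\sigma}-\tfrac14 f_{(k+\ell)\sigma}-\tfrac14 f_{(k-\ell)\sigma}\Big)_{k,\ell=1}^n,$$ $${}^{\tau}_{\sigma}K_n:=\Big(\tfrac12F_{\tau+k\sigma}+\tfrac12F_{\tau+\ell\sigma}-\tfrac14F_{\tau+(k+\ell)\sigma}-\tfrac14F_{\tau+(k-\ell)\sigma}\Big)_{k,\ell=1}^n .$$ *)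

theory Defs
  imports Complex_Main "HOL-Computational_Algebra.Polynomial" "Jordan_Normal_Form.Matrix"
begin

definition spread_poly :: "nat \<Rightarrow> real poly" where
  "spread_poly m = (THE p. \<forall>\<theta>. poly p ((sin \<theta>)\<^sup>2) = (sin (real m * \<theta>))\<^sup>2)"

text \<open>The description above is well defined; existence comes from the three-term recurrence.\<close>

fun spread_rec :: "nat \<Rightarrow> real poly" where
  "spread_rec 0 = 0"
| "spread_rec (Suc 0) = [:0, 1:]"
| "spread_rec (Suc (Suc m)) = [:2, -4:] * spread_rec (Suc m) - spread_rec m + [:0, 2:]"

lemma poly_spread_rec: "poly (spread_rec m) ((sin \<theta>)\<^sup>2) = (sin (real m * \<theta>))\<^sup>2"
proof (induction m rule: spread_rec.induct)
  case (3 m)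
  define a where "a = (real m + 1) * \<theta>"
  have e: "real (Suc (Suc m)) * \<theta> = a + \<theta>" "real (Suc m) * \<theta> = a" "real m * \<theta> = a - \<theta>"
    by (simp_all add: a_def algebra_simps)
  have c: "(cos x)\<^sup>2 = 1 - (sin x)\<^sup>2" for x :: real
    by (simp add: cos_squared_eq)
  have "(sin (a + \<theta>))\<^sup>2 + (sin (a - \<theta>))\<^sup>2
      = 2 * (sin a)\<^sup>2 * (cos \<theta>)\<^sup>2 + 2 * (cos a)\<^sup>2 * (sin \<theta>)\<^sup>2"
    by (simp add: sin_add sin_diff power2_eq_square algebra_simps)
  also have "\<dots> = (2 - 4 * (sin \<theta>)\<^sup>2) * (sin a)\<^sup>2 + 2 * (sin \<theta>)\<^sup>2"
    by (simp add: c algebra_simps)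
  finally show ?case
    using 3 unfolding e by (simp add: algebra_simps)
qed auto

lemma spread_poly_unique:
  assumes "\<forall>\<theta>. poly p ((sin \<theta>)\<^sup>2) = (sin (real m * \<theta>))\<^sup>2"
  shows "p = spread_rec m"
proof -
  have "poly (p - spread_rec m) t = 0" if "t \<in> {0..1}" for t
  proof -
    have "t = (sin (arcsin (sqrt t)))\<^sup>2"
      using that by (subst sin_arcsin) (auto intro: order.trans[of _ 0])
    then show ?thesis
      using assms poly_spread_rec by (metis poly_diff right_minus_eq)
  qed
  then have "{0..1} \<subseteq> {t. poly (p - spread_rec m) t = 0}"
    by blast
  then have "infinite {t. poly (p - spread_rec m) t = 0}"
    by (rule infinite_super) (simp add: infinite_Icc)
  then show ?thesis
    using poly_roots_finite[of "p - spread_rec m"] by (metis right_minus_eq)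
qed

lemma spread_poly_eq: "spread_poly m = spread_rec m"
  unfolding spread_poly_def
  by (rule the_equality) (use poly_spread_rec spread_poly_unique in auto)

lemma poly_spread_poly: "poly (spread_poly m) ((sin \<theta>)\<^sup>2) = (sin (real m * \<theta>))\<^sup>2"
  by (simp add: spread_poly_eq poly_spread_rec)

lemma degree_spread_poly: "degree (spread_poly m) = m"
proof -
  have "degree (spread_rec m) = m"
  proof (induction m rule: spread_rec.induct)
    case (3 m)
    have "spread_rec (Suc m) \<noteq> 0"
      using 3 by force
    then have d: "degree ([:2, -4:] * spread_rec (Suc m)) = Suc (Suc m)"
      using 3 by (subst degree_mult_eq) auto
    have "degree (- spread_rec m + [:0, 2:]) < Suc (Suc m)"
      using 3 by (intro degree_add_less) auto
    then have "degree ([:2, -4:] * spread_rec (Suc m) + (- spread_rec m + [:0, 2:])) = Suc (Suc m)"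
      using d by (subst degree_add_eq_left) simp_all
    then show ?case
      by (simp only: spread_rec.simps diff_conv_add_uminus add.assoc)
  qed auto
  then show ?thesis
    by (simp add: spread_poly_eq)
qed

definition J_entry :: "(int \<Rightarrow> complex) \<Rightarrow> int \<Rightarrow> int \<Rightarrow> int \<Rightarrow> complex" where
  "J_entry f \<sigma> k l =
     f (k * \<sigma>) / 2 + f (l * \<sigma>) / 2 - f ((k + l) * \<sigma>) / 4 - f ((k - l) * \<sigma>) / 4"

text \<open>\<open>F_comb f \<sigma> \<tau> j\<close> is the combination written $F_{\tau+j\sigma}$; it depends on the
  triple, not just on the integer \<open>\<tau> + j * \<sigma>\<close>.\<close>

definition F_comb :: "(int \<Rightarrow> complex) \<Rightarrow> int \<Rightarrow> int \<Rightarrow> int \<Rightarrow> complex" where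
  "F_comb f \<sigma> \<tau> j =
     (f \<tau> + f (j * \<sigma>)) / 2 - (f (\<tau> + j * \<sigma>) + f (\<tau> - j * \<sigma>)) / 4"

definition K_entry :: "(int \<Rightarrow> complex) \<Rightarrow> int \<Rightarrow> int \<Rightarrow> int \<Rightarrow> int \<Rightarrow> complex" where
  "K_entry f \<sigma> \<tau> k l =
     F_comb f \<sigma> \<tau> k / 2 + F_comb f \<sigma> \<tau> l / 2
       - F_comb f \<sigma> \<tau> (k + l) / 4 - F_comb f \<sigma> \<tau> (k - l) / 4"

text \<open>Library matrices are indexed from 0, the mathematical row and column indices from 1;
  hence the shifts by \<open>Suc\<close>.\<close>

definition J_mat :: "(int \<Rightarrow> complex) \<Rightarrow> int \<Rightarrow> nat \<Rightarrow> complex mat" where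
  "J_mat f \<sigma> n = Matrix.mat n n (\<lambda>(a, b). J_entry f \<sigma> (int (Suc a)) (int (Suc b)))"

definition K_mat :: "(int \<Rightarrow> complex) \<Rightarrow> int \<Rightarrow> int \<Rightarrow> nat \<Rightarrow> complex mat" where
  "K_mat f \<sigma> \<tau> n = Matrix.mat n n (\<lambda>(a, b). K_entry f \<sigma> \<tau> (int (Suc a)) (int (Suc b)))"

end

theory Submission
  imports Defs
begin

text \<open>Each frequency \<open>x\<close> contributes \<open>g s = sin\<^sup>2 (x s)\<close>, for which the combination
  \<open>g a / 2 + g b / 2 - g (a + b) / 4 - g (a - b) / 4\<close> equals the product \<open>g a * g b\<close>. By linearity
  the combination turns a superposition of such functions into a diagonalised bilinear form.
  Both \<open>F_comb\<close> and \<open>K_entry\<close> are instances of this combination, so the matrix \<open>K\<close>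
  arises by applying it twice.\<close>

text \<open>By the addition formulas, the mixed terms
  \<open>2 * sin u * cos u * sin v * cos v\<close> in the squares of \<open>sin (u + v)\<close> and
  \<open>sin (u - v)\<close> have opposite signs and cancel on adding.\<close>

lemma sin_squared_product:
  fixes u v :: real
  shows "(sin u)\<^sup>2 / 2 + (sin v)\<^sup>2 / 2 - (sin (u + v))\<^sup>2 / 4 - (sin (u - v))\<^sup>2 / 4
    = (sin u)\<^sup>2 * (sin v)\<^sup>2"
proof -
  have "(sin (u + v))\<^sup>2 + (sin (u - v))\<^sup>2 = 2 * (sin u)\<^sup>2 * (cos v)\<^sup>2 + 2 * (cos u)\<^sup>2 * (sin v)\<^sup>2"
    by (simp add: sin_add sin_diff power2_eq_square algebra_simps)
  also have "\<dots> = 2 * (sin u)\<^sup>2 + 2 * (sin v)\<^sup>2 - 4 * ((sin u)\<^sup>2 * (sin v)\<^sup>2)"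
    by (simp add: cos_squared_eq algebra_simps)
  finally show ?thesis
    by (simp add: field_simps)
qed

text \<open>Linearity reduces this to one frequency. The weights \<open>c\<close> and real
  frequencies \<open>x\<close> are arbitrary, so that the result applies to the samples and again to
  \<open>F_comb\<close>.\<close>

lemma J_entry_sum_sin_squared:
  fixes c :: "'i \<Rightarrow> complex" and x :: "'i \<Rightarrow> real"
  shows "J_entry (\<lambda>s. \<Sum>i\<in>I. c i * of_real ((sin (x i * of_int s))\<^sup>2)) \<sigma> k l
    = (\<Sum>i\<in>I. c i * of_real ((sin (x i * of_int (k * \<sigma>)))\<^sup>2)
        * of_real ((sin (x i * of_int (l * \<sigma>)))\<^sup>2))"
proof -
  have "c i * of_real ((sin (x i * of_int (k * \<sigma>)))\<^sup>2) / 2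
      + c i * of_real ((sin (x i * of_int (l * \<sigma>)))\<^sup>2) / 2
      - c i * of_real ((sin (x i * of_int ((k + l) * \<sigma>)))\<^sup>2) / 4
      - c i * of_real ((sin (x i * of_int ((k - l) * \<sigma>)))\<^sup>2) / 4
    = c i * of_real ((sin (x i * of_int (k * \<sigma>)))\<^sup>2)
        * of_real ((sin (x i * of_int (l * \<sigma>)))\<^sup>2)" (is "?lhs = ?rhs") for i
  proof -
    define u v where "u = x i * of_int (k * \<sigma>)" and "v = x i * of_int (l * \<sigma>)"
    have e: "x i * of_int ((k + l) * \<sigma>) = u + v" "x i * of_int ((k - l) * \<sigma>) = u - v"
      by (simp_all add: u_def v_def algebra_simps)
    have "?lhs = c i * of_real
        ((sin u)\<^sup>2 / 2 + (sin v)\<^sup>2 / 2 - (sin (u + v))\<^sup>2 / 4 - (sin (u - v))\<^sup>2 / 4)"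
      unfolding e by (simp add: u_def v_def algebra_simps)
    then show ?thesis
      by (simp only: sin_squared_product of_real_mult mult.assoc u_def v_def)
  qed
  then show ?thesis
    by (simp only: J_entry_def sum_divide_distrib flip: sum.distrib sum_subtractf)
qed

text \<open>The spacing is 1 because \<open>\<tau>\<close> need not be a multiple of
  \<open>\<sigma>\<close>; the factor \<open>\<sigma>\<close> goes into the second index.\<close>

lemma F_comb_eq_J_entry: "F_comb f \<sigma> \<tau> j = J_entry f 1 \<tau> (j * \<sigma>)"
  by (simp add: F_comb_def J_entry_def add_divide_distrib)

text \<open>Again spacing 1: \<open>F_comb\<close> is a function of \<open>j\<close>, and
  \<open>\<sigma>\<close> is already absorbed in it.\<close>

lemma K_entry_eq_J_entry: "K_entry f \<sigma> \<tau> k l = J_entry (F_comb f \<sigma> \<tau>) 1 k l"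
  by (simp add: K_entry_def J_entry_def)

lemma K_entry_sum_sin_squared:
  fixes c :: "'i \<Rightarrow> complex" and x :: "'i \<Rightarrow> real"
  shows "K_entry (\<lambda>s. \<Sum>i\<in>I. c i * of_real ((sin (x i * of_int s))\<^sup>2)) \<sigma> \<tau> k l
    = (\<Sum>i\<in>I. c i * of_real ((sin (x i * of_int \<tau>))\<^sup>2)
        * of_real ((sin (x i * of_int (k * \<sigma>)))\<^sup>2)
        * of_real ((sin (x i * of_int (l * \<sigma>)))\<^sup>2))"
proof -
  \<comment> \<open>The first application, with one index fixed at \<open>\<tau>\<close>, gives a
    superposition in \<open>j\<close> again: the weights gain a factor and the frequencies become
    \<open>x i * \<sigma>\<close>. This grouping lets the second application match.\<close>
  have "F_comb (\<lambda>s. \<Sum>i\<in>I. c i * of_real ((sin (x i * of_int s))\<^sup>2)) \<sigma> \<tau>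
    = (\<lambda>j. \<Sum>i\<in>I. (c i * of_real ((sin (x i * of_int \<tau>))\<^sup>2))
        * of_real ((sin ((x i * of_int \<sigma>) * of_int j))\<^sup>2))"
    by (rule ext) (simp only: F_comb_eq_J_entry J_entry_sum_sin_squared of_int_mult of_int_1 mult_1_right
        mult.assoc mult.commute[of "of_int \<sigma> :: real"])
  then show ?thesis
    by (simp only: K_entry_eq_J_entry J_entry_sum_sin_squared) (simp add: ac_simps)
qed

text \<open>Right multiplication by a diagonal matrix scales the columns. This turns the sums found
  for the entries into matrix products.\<close>

lemma mat_mult_diag_mult_transpose:
  fixes r :: "nat \<Rightarrow> nat \<Rightarrow> 'a :: comm_ring_1"
  shows "Matrix.mat n n (\<lambda>(a, b). r a b) * mat_diag n d * transpose_mat (Matrix.mat n n (\<lambda>(a, b). r a b))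
    = Matrix.mat n n (\<lambda>(a, b). \<Sum>i<n. d i * r a i * r b i)"
  by (rule eq_matI)
    (auto simp: mat_diag_mult_right[of _ n n] scalar_prod_def atLeast0LessThan ac_simps intro!: sum.cong)

theorem theorem3:
  fixes n M :: nat and \<sigma> \<tau> :: int and m :: "nat \<Rightarrow> nat" and \<Delta> :: real
    and \<alpha> :: "nat \<Rightarrow> complex" and f :: "int \<Rightarrow> complex" and R L A :: "complex mat"
  assumes "n > 0" and "\<sigma> > 0" and "M > 0"
    and "\<forall>i\<in>{1..n}. 0 < m i \<and> m i < M" and "strict_mono_on {1..n} m"
    and "0 < \<Delta>" and "\<Delta> \<le> pi / (2 * real M)"
    and "\<forall>s. f s = (\<Sum>i=1..n. \<alpha> i *
          complex_of_real (poly (spread_poly (m i)) ((sin (real_of_int s * \<Delta>))\<^sup>2)))"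
    and "R = Matrix.mat n n (\<lambda>(a, b). complex_of_real
          (poly (spread_poly (m (Suc b))) ((sin (real (Suc a) * real_of_int \<sigma> * \<Delta>))\<^sup>2)))"
    and "A = mat_diag n (\<lambda>a. \<alpha> (Suc a))"
    and "L = mat_diag n (\<lambda>a. complex_of_real
          (poly (spread_poly (m (Suc a))) ((sin (real_of_int \<tau> * \<Delta>))\<^sup>2)))"
  shows "K_mat f \<sigma> \<tau> n = R * L * A * transpose_mat R
    \<and> J_mat f \<sigma> n = R * A * transpose_mat R
    \<and> L = mat_diag n (\<lambda>a. complex_of_real
          ((sin (real (m (Suc a)) * real_of_int \<tau> * \<Delta>))\<^sup>2))"
proof -
  \<comment> \<open>The angular frequencies of the samples, shifted to start at index 0 as the
    matrices do.\<close>
  define x where "x i = real (m (Suc i)) * \<Delta>" for i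
  define r where "r a i = complex_of_real ((sin (x i * of_int (int (Suc a) * \<sigma>)))\<^sup>2)" for a i
  have f: "f = (\<lambda>s. \<Sum>i<n. \<alpha> (Suc i) * complex_of_real ((sin (x i * of_int s))\<^sup>2))"
  proof
    fix s
    have "f s = (\<Sum>i=1..n. \<alpha> i * complex_of_real ((sin (real (m i) * (of_int s * \<Delta>)))\<^sup>2))"
      using assms(8) by (simp only: poly_spread_poly)
    also have "\<dots> = (\<Sum>i<n. \<alpha> (Suc i) * complex_of_real ((sin (x i * of_int s))\<^sup>2))"
      by (simp add: x_def ac_simps sum.atLeast1_atMost_eq)
    finally show "f s = \<dots>" .
  qed
  have R: "R = Matrix.mat n n (\<lambda>(a, i). r a i)"
    unfolding assms(9) r_def x_def poly_spread_poly by (simp add: ac_simps)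
  have L: "L = mat_diag n (\<lambda>i. complex_of_real ((sin (x i * of_int \<tau>))\<^sup>2))"
    unfolding assms(11) x_def poly_spread_poly by (simp add: ac_simps)
  \<comment> \<open>Merging \<open>L\<close> and \<open>A\<close> into one diagonal matrix gives
    exactly the weights produced by \<open>K_entry_sum_sin_squared\<close>.\<close>
  have "R * L * A = R * (L * A)"
    by (rule assoc_mult_mat[of _ n n _ n _ n]) (auto simp: R L assms(10))
  also have "L * A = mat_diag n
      (\<lambda>i. \<alpha> (Suc i) * complex_of_real ((sin (x i * of_int \<tau>))\<^sup>2))"
    by (simp add: L assms(10) ac_simps)
  finally have "R * L * A * transpose_mat R = K_mat f \<sigma> \<tau> n"
    by (simp only: R mat_mult_diag_mult_transpose K_mat_def f K_entry_sum_sin_squared r_def)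
  moreover have "R * A * transpose_mat R = J_mat f \<sigma> n"
    by (simp only: R assms(10) mat_mult_diag_mult_transpose J_mat_def f J_entry_sum_sin_squared r_def)
  moreover have "L = mat_diag n (\<lambda>a. complex_of_real ((sin (real (m (Suc a)) * of_int \<tau> * \<Delta>))\<^sup>2))"
    by (simp add: L x_def ac_simps)
  ultimately show ?thesis
    by simp
qed

end
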